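(* For every positive integer $m$, \[\sum_{n=m}^\infty\frac{\bar H_n\, s(n,m)}{n\,n!}=\zeta(2,\{1\}^{m-1})\ln 2-\zeta(\bar 2,\{1\}^{m-1})\ln 2-(m+1)\,\zeta(\bar 2,\{1\}^{m}).\]
   Context: $\bar H_n=\sum_{j=1}^n(-1)^{j-1}/j$. $s(n,k)$ denotes the unsigned Stirling numbers of the first kind, with $\ln^k(1-x)=(-1)^kk!\sum_{n\ge k}s(n,k)x^n/n!$. For $k\ge 0$, $\{1\}^{k}$ denotes $k$ repetitions of $1$. Multiple zeta values use decreasing summation indices: \[\zeta(2,\{1\}^{k})=\sum_{n_1>n_2>\cdots>n_{k+1}\ge1}\frac1{n_1^2n_2\cdots n_{k+1}},\qquad \zeta(\bar2,\{1\}^{k})=\sum_{n_1>n_2>\cdots>n_{k+1}\ge1}\frac{(-1)^{n_1}}{n_1^2n_2\cdots n_{k+1}}.\] *)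

theory Defs
  imports "HOL-Analysis.Analysis" "HOL-Combinatorics.Stirling"
begin

definition alt_harm :: "nat \<Rightarrow> real" where
  "alt_harm n = (\<Sum>j=1..n. (-1) ^ (j - 1) / real j)"

text \<open>
  A summation index \<open>n\<^sub>1 > \<dots> > n\<^sub>d \<ge> 1\<close> of depth \<open>d\<close> is the list \<open>[n\<^sub>1, \<dots>, n\<^sub>d]\<close>.
\<close>
definition decreasing_indices :: "nat \<Rightarrow> nat list set" where
  "decreasing_indices d = {ns. length ns = d \<and> sorted_wrt (>) ns \<and> (\<forall>n\<in>set ns. n \<ge> 1)}"

text \<open>
  \<open>zeta_2_ones k\<close> is $\zeta(2,\{1\}^k)$ and \<open>zeta_bar2_ones k\<close> is $\zeta(\bar 2,\{1\}^k)$, both of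
  depth \<open>k + 1\<close>. Both multiple series converge absolutely, so the unordered sum is
  their value.
\<close>
definition zeta_2_ones :: "nat \<Rightarrow> real" where
  "zeta_2_ones k =
     (\<Sum>\<^sub>\<infinity>ns\<in>decreasing_indices (k + 1). 1 / (real (hd ns) ^ 2 * (\<Prod>n\<leftarrow>tl ns. real n)))"

definition zeta_bar2_ones :: "nat \<Rightarrow> real" where
  "zeta_bar2_ones k =
     (\<Sum>\<^sub>\<infinity>ns\<in>decreasing_indices (k + 1).
        (-1) ^ hd ns / (real (hd ns) ^ 2 * (\<Prod>n\<leftarrow>tl ns. real n)))"

end

theory Submission
  imports Defs
begin

text \<open>
  Write \<open>L = - ln (1 - x)\<close> and \<open>a m n = s(n,m) / (n n!)\<close>. Splitting the multiple sums by their
  largest index gives \<open>\<zeta>(2,{1}\<^sup>k) = \<Sum>n. a (k+1) n\<close>, and likewise with signs for the barred values.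
  The identity \<open>L * L^m / m! = (m + 1) * L^(m+1) / (m+1)!\<close> reads, on coefficients,
  \<open>\<Sum>n<N. a m n / (N - n) = (m + 1) * a (m+1) N + (\<Sum>n<N. a m n) / N\<close>.
  Multiply this by \<open>(-1)^N\<close> and sum over \<open>N\<close>. The left-hand side is a Cauchy product of an absolutely
  convergent series with the alternating harmonic series, so it converges by Mertens' theorem;
  the last term is summed by exchanging the order of summation, which produces the
  alternating harmonic numbers.
\<close>

section \<open>Summability of the coefficient series\<close>

definition stirling_term :: "nat \<Rightarrow> nat \<Rightarrow> real" where
  "stirling_term m n = real (stirling n m) / (real n * fact n)"

lemma stirling_term_nonneg: "stirling_term m n \<ge> 0"
  by (simp add: stirling_term_def)

lemma stirling_term_0_right [simp]: "stirling_term m 0 = 0"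
  by (simp add: stirling_term_def)

text \<open>Comparison with a telescoping series. Evaluating
  \<open>(\<Sum>k\<le>n. s(n,k) * x ^ k) = pochhammer x n\<close> at \<open>x = 1/2\<close> and
  keeping one term bounds \<open>s(n,m)\<close> by \<open>2 ^ m * pochhammer (1/2) n\<close>. Since
  \<open>p\<close> decreases and is bounded below, its differences are summable, and they are
  comparable to \<open>p n / n\<close>.\<close>

lemma summable_stirling_term: "summable (stirling_term m)"
proof -
  define p :: "nat \<Rightarrow> real" where "p n = pochhammer (1/2) n / fact n" for n
  have p_Suc: "p (Suc n) = p n * ((1/2 + real n) / real (Suc n))" for n
    by (simp add: p_def pochhammer_Suc field_simps)
  have p_nonneg: "p n \<ge> 0" for n
    by (simp add: p_def pochhammer_nonneg)
  have diff: "p n - p (Suc n) = p n / (2 * real (Suc n))" for n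
    by (simp add: p_Suc field_simps)
  have "decseq p"
  proof (rule decseq_SucI)
    fix n
    have "0 \<le> p n / (2 * real (Suc n))"
      using p_nonneg by simp
    then show "p (Suc n) \<le> p n"
      using diff [of n] by linarith
  qed
  then obtain L where "p \<longlonglongrightarrow> L"
    using decseq_convergent [of p 0] p_nonneg by blast
  then have "summable (\<lambda>n. p n - p (Suc n))"
    by (rule telescope_summable')
  \<comment> \<open>The 4 is 2 * 2: one factor comes from \<open>diff\<close>, the other from
    \<open>1 / n \<le> 2 / (n + 1)\<close>.\<close>
  then have sp: "summable (\<lambda>n. 2 ^ m * 4 * (p n - p (Suc n)))"
    by (rule summable_mult)
  show ?thesis
  proof (rule summable_comparison_test' [OF sp, of 1])
    fix n :: nat
    assume n: "n \<ge> 1"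
    have "real (stirling n m) \<le> 2 ^ m * pochhammer (1/2) n"
    proof (cases "m \<le> n")
      case True
      have "real (stirling n m) * (1/2) ^ m \<le> (\<Sum>k\<le>n. real (stirling n k) * (1/2) ^ k)"
        using True by (intro member_le_sum) auto
      then show ?thesis
        unfolding stirling_pochhammer by (simp add: field_simps)
    qed (simp add: pochhammer_nonneg)
    then have "stirling_term m n \<le> 2 ^ m * p n / real n"
      using n by (simp add: stirling_term_def p_def field_simps)
    also have "\<dots> \<le> 2 ^ m * 4 * (p n - p (Suc n))"
    proof -
      have "1 / real n \<le> 2 / real (Suc n)"
        using n by (simp add: field_simps)
      moreover have "4 * (p n - p (Suc n)) = p n * (2 / real (Suc n))"
        unfolding diff by (simp add: field_simps)
      ultimately have "p n / real n \<le> 4 * (p n - p (Suc n))"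
        using mult_left_mono [OF _ p_nonneg [of n]] by fastforce
      from mult_left_mono [OF this, of "2 ^ m"] show ?thesis
        by (simp only: times_divide_eq_right mult.assoc) simp
    qed
    finally show "norm (stirling_term m n) \<le> 2 ^ m * 4 * (p n - p (Suc n))"
      by (simp add: stirling_term_nonneg)
  qed
qed

section \<open>Multiple zeta values as single series\<close>

text \<open>With largest index \<open>n + 1\<close> fixed, the remaining indices range over exactly
  this finite set.\<close>

definition bounded_indices :: "nat \<Rightarrow> nat \<Rightarrow> nat list set" where
  "bounded_indices k n = {ns \<in> decreasing_indices k. \<forall>x\<in>set ns. x \<le> n}"

lemma bounded_indices_0: "bounded_indices 0 n = {[]}"
  by (auto simp: bounded_indices_def decreasing_indices_def)

lemma bounded_indices_Suc_0: "bounded_indices (Suc k) 0 = {}"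
  by (fastforce simp: bounded_indices_def decreasing_indices_def length_Suc_conv)

lemma bounded_indices_Suc_Suc:
  "bounded_indices (Suc k) (Suc n) = bounded_indices (Suc k) n \<union> (#) (Suc n) ` bounded_indices k n"
  (is "?A = ?B")
proof (intro equalityI subsetI)
  fix ns
  assume ns: "ns \<in> ?A"
  then obtain x xs where [simp]: "ns = x # xs"
    by (auto simp: bounded_indices_def decreasing_indices_def length_Suc_conv)
  show "ns \<in> ?B"
  proof (cases "x = Suc n")
    case True
    then have "xs \<in> bounded_indices k n"
      using ns by (auto simp: bounded_indices_def decreasing_indices_def less_Suc_eq_le)
    then show ?thesis
      using True by simp
  next
    case False
    then have "x \<le> n"
      using ns by (auto simp: bounded_indices_def)
    then have "\<forall>y\<in>set ns. y \<le> n"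
      using ns by (auto simp: bounded_indices_def decreasing_indices_def)
    then show ?thesis
      using ns by (simp add: bounded_indices_def)
  qed
next
  fix ns
  assume "ns \<in> ?B"
  then show "ns \<in> ?A"
    by (auto simp: bounded_indices_def decreasing_indices_def less_Suc_eq_le intro: le_SucI)
qed

lemma finite_bounded_indices: "finite (bounded_indices k n)"
proof (rule finite_subset)
  show "bounded_indices k n \<subseteq> {ns. set ns \<subseteq> {..n} \<and> length ns = k}"
    by (auto simp: bounded_indices_def decreasing_indices_def)
qed (simp add: finite_lists_length_eq)

text \<open>The sum is the elementary symmetric polynomial of degree \<open>k\<close> in 1, 1/2,
  ..., 1/n. Splitting by whether the largest index is \<open>n + 1\<close> reproduces the Stirling
  recurrence divided by \<open>(n + 1)!\<close>.\<close>

lemma sum_bounded_indices: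
  "(\<Sum>ns\<in>bounded_indices k n. 1 / (\<Prod>i\<leftarrow>ns. real i)) = real (stirling (Suc n) (Suc k)) / fact n"
proof (induction n arbitrary: k)
  case 0
  show ?case
    by (cases k) (simp_all add: bounded_indices_0 bounded_indices_Suc_0)
next
  case (Suc n)
  show ?case
  proof (cases k)
    case 0
    then show ?thesis
      by (simp add: bounded_indices_0 stirling_Suc_n_1 del: stirling.simps fact_Suc)
  next
    case (Suc j)
    have "bounded_indices (Suc j) n \<inter> (#) (Suc n) ` bounded_indices j n = {}"
      by (auto simp: bounded_indices_def)
    then have "(\<Sum>ns\<in>bounded_indices k (Suc n). 1 / (\<Prod>i\<leftarrow>ns. real i)) =
        (\<Sum>ns\<in>bounded_indices (Suc j) n. 1 / (\<Prod>i\<leftarrow>ns. real i)) +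
        (\<Sum>ns\<in>bounded_indices j n. 1 / (\<Prod>i\<leftarrow>ns. real i)) / real (Suc n)"
      by (simp add: Suc bounded_indices_Suc_Suc sum.union_disjoint finite_bounded_indices
          sum.reindex sum_divide_distrib mult.commute)
    also have "\<dots> = real (stirling (Suc (Suc n)) (Suc k)) / fact (Suc n)"
      unfolding Suc.IH Suc stirling.simps(4) [of "Suc n"] by (simp add: field_simps del: stirling.simps of_nat_Suc) (simp add: algebra_simps del: stirling.simps)
    finally show ?thesis .
  qed
qed

text \<open>The weight \<open>c\<close> lets one proof serve both kinds of zeta value: it is later
  taken to be 1 or \<open>(-1) ^ n\<close>. The multiple sum is grouped by its largest index, and
  the inner finite sums are evaluated by \<open>sum_bounded_indices\<close>.\<close>

lemma has_sum_decreasing_indices: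
  fixes c :: "nat \<Rightarrow> real"
  assumes c: "\<And>n. \<bar>c n\<bar> \<le> 1"
  shows "((\<lambda>ns. c (hd ns) / (real (hd ns) ^ 2 * (\<Prod>n\<leftarrow>tl ns. real n))) has_sum
          (\<Sum>n. c n * stirling_term (k + 1) n)) (decreasing_indices (k + 1))"
proof -
  define f where "f c = (\<lambda>(n, ns). c (Suc n) * (1 / (real (Suc n) ^ 2 * (\<Prod>i\<leftarrow>ns. real i)))) "
    for c :: "nat \<Rightarrow> real"
  have inner: "((\<lambda>ns. f c (n, ns)) has_sum c (Suc n) * stirling_term (k + 1) (Suc n)) (bounded_indices k n)"
    for c n
  proof -
    have "(\<Sum>ns\<in>bounded_indices k n. f c (n, ns)) =
        c (Suc n) / real (Suc n) ^ 2 * (\<Sum>ns\<in>bounded_indices k n. 1 / (\<Prod>i\<leftarrow>ns. real i))"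
      by (simp add: f_def sum_distrib_left)
    also have "\<dots> = c (Suc n) * stirling_term (k + 1) (Suc n)"
      unfolding sum_bounded_indices stirling_term_def
      by (simp add: power2_eq_square del: stirling.simps of_nat_Suc)
    finally show ?thesis
      using has_sum_finite [OF finite_bounded_indices, of "\<lambda>ns. f c (n, ns)" k n] by simp
  qed
  have s1: "summable (\<lambda>n. stirling_term (k + 1) (Suc n))"
    using summable_stirling_term by (subst summable_Suc_iff)
  \<comment> \<open>Grouping a signed family requires its joint summability first. The nonnegative
    case \<open>c = 1\<close> provides it and dominates every other weight.\<close>
  have dom: "f (\<lambda>_. 1) summable_on Sigma UNIV (bounded_indices k)"
  proof (rule summable_on_SigmaI)
    show "((\<lambda>ns. f (\<lambda>_. 1) (n, ns)) has_sum stirling_term (k + 1) (Suc n)) (bounded_indices k n)" for n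
      using inner [of "\<lambda>_. 1" n] by simp
    show "(\<lambda>n. stirling_term (k + 1) (Suc n)) summable_on UNIV"
      using s1 by (subst summable_on_UNIV_nonneg_real_iff) (simp_all add: stirling_term_nonneg)
    show "f (\<lambda>_. 1) (n, ns) \<ge> 0" for n ns
      unfolding f_def by (auto intro!: prod_list_nonneg divide_nonneg_nonneg mult_nonneg_nonneg)
  qed
  have sf: "f c summable_on Sigma UNIV (bounded_indices k)"
  proof (rule abs_summable_summable, rule summable_on_comparison_test [OF dom])
    fix x
    have "0 \<le> f (\<lambda>_. 1) x"
      unfolding f_def by (auto intro!: prod_list_nonneg divide_nonneg_nonneg mult_nonneg_nonneg split: prod.split)
    moreover have "f c x = c (Suc (fst x)) * f (\<lambda>_. 1) x"
      by (simp add: f_def split: prod.split)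
    ultimately show "norm (f c x) \<le> f (\<lambda>_. 1) x"
      using mult_right_mono [OF c] by (simp add: abs_mult)
  qed simp
  have norm_le: "norm (c n * stirling_term (k + 1) n) \<le> stirling_term (k + 1) n" for n
    using mult_right_mono [OF c stirling_term_nonneg] by (simp add: abs_mult stirling_term_nonneg)
  have sn: "summable (\<lambda>n. norm (c n * stirling_term (k + 1) n))"
    by (rule summable_comparison_test' [OF summable_stirling_term [of "k + 1"], of 0]) (use norm_le in auto)
  have "(\<lambda>n. c n * stirling_term (k + 1) n) sums (\<Sum>n. c n * stirling_term (k + 1) n)"
    by (rule summable_sums [OF summable_norm_cancel [OF sn]])
  then have "(\<lambda>n. c (Suc n) * stirling_term (k + 1) (Suc n)) sums (\<Sum>n. c n * stirling_term (k + 1) n)"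
    by (subst sums_Suc_iff) simp
  moreover have "summable (\<lambda>n. norm (c (Suc n) * stirling_term (k + 1) (Suc n)))"
    using sn by (subst summable_Suc_iff)
  ultimately have outer: "((\<lambda>n. c (Suc n) * stirling_term (k + 1) (Suc n)) has_sum
      (\<Sum>n. c n * stirling_term (k + 1) n)) UNIV"
    by (intro norm_summable_imp_has_sum)
  have "(f c has_sum (\<Sum>n. c n * stirling_term (k + 1) n)) (Sigma UNIV (bounded_indices k))"
    by (rule has_sum_SigmaI [OF inner outer sf])
  moreover have "bij_betw (\<lambda>(n, ns). Suc n # ns) (Sigma UNIV (bounded_indices k)) (decreasing_indices (k + 1))"
  proof (rule bij_betw_byWitness [where f' = "\<lambda>ns. (hd ns - 1, tl ns)"])
    show "(\<lambda>ns. (hd ns - 1, tl ns)) ` decreasing_indices (k + 1) \<subseteq> Sigma UNIV (bounded_indices k)"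
      by (fastforce simp: decreasing_indices_def bounded_indices_def length_Suc_conv)
  qed (auto simp: decreasing_indices_def bounded_indices_def length_Suc_conv less_Suc_eq_le)
  ultimately show ?thesis
    by (subst has_sum_reindex_bij_betw [symmetric]) (auto simp: f_def case_prod_unfold)
qed

lemma zeta_2_ones_eq: "zeta_2_ones k = (\<Sum>n. stirling_term (k + 1) n)"
  using infsumI [OF has_sum_decreasing_indices [of "\<lambda>_. 1" k]] by (simp add: zeta_2_ones_def)

lemma zeta_bar2_ones_eq: "zeta_bar2_ones k = (\<Sum>n. (-1) ^ n * stirling_term (k + 1) n)"
  using infsumI [OF has_sum_decreasing_indices [of "\<lambda>n. (-1) ^ n" k]] by (simp add: zeta_bar2_ones_def)

section \<open>The convolution identity\<close>

text \<open>This is the series of \<open>L^m / m!\<close>.\<close>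

definition stirling_fps :: "nat \<Rightarrow> real fps" where
  "stirling_fps m = Abs_fps (\<lambda>n. real (stirling n m) / fact n)"

text \<open>The coefficient of index 0 is \<open>1 / 0 = 0\<close>.\<close>
definition log_fps :: "real fps" where
  "log_fps = Abs_fps (\<lambda>n. 1 / real n)"

lemma fps_deriv_log: "(1 - fps_X) * fps_deriv log_fps = 1"
proof (rule fps_ext)
  fix n
  show "fps_nth ((1 - fps_X) * fps_deriv log_fps) n = fps_nth 1 n"
    by (cases n) (simp_all add: log_fps_def left_diff_distrib)
qed

text \<open>The formal version of \<open>(L^(m+1) / (m+1)!)' = L^m / m! * L'\<close>. The Stirling
  recurrence gives it multiplied by \<open>1 - x\<close>, and \<open>fps_deriv_log\<close> removes
  that factor.\<close>

lemma fps_deriv_stirling: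
  "fps_deriv (stirling_fps (Suc m)) = stirling_fps m * fps_deriv log_fps"
proof -
  have "(1 - fps_X) * fps_deriv (stirling_fps (Suc m)) = stirling_fps m"
  proof (rule fps_ext)
    fix n
    show "fps_nth ((1 - fps_X) * fps_deriv (stirling_fps (Suc m))) n = fps_nth (stirling_fps m) n"
    proof (cases n)
      case (Suc j)
      have "real (Suc n) * (real (stirling (Suc n) (Suc m)) / fact (Suc n)) =
          real (stirling (Suc n) (Suc m)) / fact n"
        by (simp del: stirling.simps of_nat_Suc)
      also have "\<dots> = real n * (real (stirling n (Suc m)) / fact n) + real (stirling n m) / fact n"
        by (simp add: add_divide_distrib)
      finally show ?thesis
        by (simp add: Suc stirling_fps_def left_diff_distrib del: stirling.simps of_nat_Suc fact_Suc)
    qed (simp add: stirling_fps_def left_diff_distrib)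
  qed
  then have "fps_deriv (stirling_fps (Suc m)) * ((1 - fps_X) * fps_deriv log_fps) =
      stirling_fps m * fps_deriv log_fps"
    by (simp add: mult_ac)
  then show ?thesis
    by (simp add: fps_deriv_log)
qed

text \<open>Induction by comparing derivatives: the product rule yields one copy of
  \<open>L' * stirling_fps (m + 1)\<close> directly and \<open>m + 1\<close> more from the induction
  hypothesis. Both sides have constant coefficient 0.\<close>

lemma log_fps_mult_stirling_fps:
  "log_fps * stirling_fps m = of_nat (m + 1) * stirling_fps (m + 1)"
proof (induction m)
  case 0
  have "stirling_fps 0 = 1"
    by (rule fps_ext) (auto simp: stirling_fps_def)
  moreover have "log_fps = stirling_fps 1"
  proof (rule fps_ext)
    fix n
    show "fps_nth log_fps n = fps_nth (stirling_fps 1) n"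
      by (cases n) (simp_all add: log_fps_def stirling_fps_def stirling_Suc_n_1 del: stirling.simps(4))
  qed
  ultimately show ?case
    by simp
next
  case (Suc m)
  have "fps_deriv (log_fps * stirling_fps (Suc m)) =
      fps_deriv log_fps * stirling_fps (Suc m) + (log_fps * stirling_fps m) * fps_deriv log_fps"
    by (simp add: fps_deriv_stirling mult_ac)
  also have "\<dots> = fps_deriv (of_nat (Suc m + 1) * stirling_fps (Suc m + 1))"
    unfolding Suc.IH by (simp add: fps_deriv_stirling algebra_simps)
  finally show ?case
    unfolding fps_deriv_eq_iff by (simp add: log_fps_def stirling_fps_def)
qed

lemma stirling_term_convolution:
  assumes "m \<ge> 1"
  shows "(\<Sum>n\<le>N. stirling_term m n * (1 / real (N - n))) =
    real (m + 1) * stirling_term (m + 1) N + (\<Sum>n<N. stirling_term m n) / real N"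
proof (cases "N = 0")
  case False
  define b where "b n = real (stirling n m) / fact n" for n
  have b_eq: "b n = real n * stirling_term m n" for n
    using assms by (cases n; cases m) (simp_all add: b_def stirling_term_def)
  have "(\<Sum>n\<le>N. b n * (1 / real (N - n))) = fps_nth (stirling_fps m * log_fps) N"
    by (simp add: fps_mult_nth stirling_fps_def log_fps_def b_def atLeast0AtMost)
  also have "\<dots> = fps_nth (of_nat (m + 1) * stirling_fps (m + 1)) N"
    by (simp only: log_fps_mult_stirling_fps mult.commute [of "stirling_fps m"])
  also have "\<dots> = real (m + 1) * (real N * stirling_term (m + 1) N)"
    using False by (simp add: fps_of_nat [symmetric] stirling_fps_def stirling_term_def
        del: of_nat_Suc stirling.simps fps_const_add)
  finally have conv: "(\<Sum>n\<le>N. b n * (1 / real (N - n))) = real (m + 1) * (real N * stirling_term (m + 1) N)" .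
  have "real N * (\<Sum>n\<le>N. stirling_term m n * (1 / real (N - n))) =
      (\<Sum>n<N. real N * (stirling_term m n * (1 / real (N - n))))"
    by (simp add: sum_distrib_left lessThan_Suc_atMost [symmetric])
  \<comment> \<open>Here \<open>N / (N - n) = n / (N - n) + 1\<close>. The term \<open>n = N\<close>
    can be added or dropped freely because \<open>1 / 0 = 0\<close>.\<close>
  also have "\<dots> = (\<Sum>n<N. b n * (1 / real (N - n)) + stirling_term m n)"
    by (intro sum.cong) (auto simp: b_eq of_nat_diff field_simps)
  also have "\<dots> = (\<Sum>n\<le>N. b n * (1 / real (N - n))) + (\<Sum>n<N. stirling_term m n)"
    by (simp add: sum.distrib lessThan_Suc_atMost [symmetric])
  finally show ?thesis
    using False unfolding conv by (simp add: field_simps)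
qed simp

section \<open>Summation\<close>

text \<open>In Mertens' theorem \<open>B\<close> is the sequence of partial sums of the second
  series. As \<open>B\<close> is bounded, Tannery's theorem applies with the majorant
  \<open>\<bar>c k\<bar> * K\<close>.\<close>

lemma mertens_tendsto:
  fixes c B :: "nat \<Rightarrow> real"
  assumes c: "summable (\<lambda>n. \<bar>c n\<bar>)" and B: "B \<longlonglongrightarrow> L"
  shows "(\<lambda>N. \<Sum>n<N. c n * B (N - n)) \<longlonglongrightarrow> (\<Sum>n. c n) * L"
proof -
  obtain K where K: "\<And>n. \<bar>B n\<bar> \<le> K"
    using convergent_imp_Bseq [OF convergentI [OF B]] unfolding Bseq_def by auto
  define a where "a k n = (if k < n then c k * B (n - k) else 0)" for k n
  have lim: "(\<lambda>n. a k n) \<longlonglongrightarrow> c k * L" for k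
  proof -
    have "(\<lambda>n. c k * B n) \<longlonglongrightarrow> c k * L"
      by (intro tendsto_intros B)
    then have "(\<lambda>n. c k * B (n + Suc k - k)) \<longlonglongrightarrow> c k * L"
      using LIMSEQ_Suc by fastforce
    then have "(\<lambda>n. a k (n + Suc k)) \<longlonglongrightarrow> c k * L"
      by (simp add: a_def)
    then show ?thesis
      by (rule LIMSEQ_offset)
  qed
  have bound: "norm (a k n) \<le> \<bar>c k\<bar> * K" for k n
    using K [of "n - k"] abs_ge_zero [of "B (n - k)"]
    by (auto simp: a_def abs_mult intro!: mult_left_mono mult_nonneg_nonneg simp del: abs_ge_zero)
  have "(\<lambda>n. suminf (\<lambda>k. a k n)) \<longlonglongrightarrow> (\<Sum>k. c k * L)"
    by (rule tannerys_theorem [where M = "\<lambda>k. \<bar>c k\<bar> * K", THEN conjunct2, THEN conjunct2])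
       (use lim bound c in \<open>auto intro: summable_mult2 always_eventually\<close>)
  moreover have "suminf (\<lambda>k. a k n) = (\<Sum>k<n. c k * B (n - k))" for n
    by (subst suminf_finite [of "{..<n}"]) (auto simp: a_def)
  moreover have "(\<Sum>k. c k * L) = (\<Sum>k. c k) * L"
    using summable_rabs_cancel [OF c] by (rule suminf_mult2 [symmetric])
  ultimately show ?thesis
    by simp
qed

lemma alt_harm_eq: "(\<Sum>j<Suc n. (-1) ^ j * (1 / real j)) = - alt_harm n"
proof (induction n)
  case (Suc n)
  then show ?case
    unfolding sum.lessThan_Suc [of _ "Suc n"] by (simp add: alt_harm_def)
qed (simp add: alt_harm_def)

lemma alt_harm_tendsto: "alt_harm \<longlonglongrightarrow> ln 2"
proof -
  have "alt_harm = (\<lambda>n. \<Sum>k<n. (-1) ^ k / real (Suc k))"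
  proof
    show "alt_harm n = (\<Sum>k<n. (-1) ^ k / real (Suc k))" for n
      by (induction n) (simp_all add: alt_harm_def)
  qed
  then show ?thesis
    using alternating_harmonic_series_sums by (simp add: sums_def)
qed

text \<open>An exact identity for every cutoff \<open>N\<close>, so that only the limits of the
  separate pieces remain to be taken.\<close>

lemma stirling_term_partial_sums:
  assumes "m \<ge> 1"
  shows "(\<Sum>n<N. alt_harm n * stirling_term m n) =
    alt_harm (N - 1) * (\<Sum>n<N. stirling_term m n)
    - (\<Sum>n<N. (-1) ^ n * stirling_term m n * alt_harm (N - n - 1))
    - real (m + 1) * (\<Sum>n<N. (-1) ^ n * stirling_term (m + 1) n)"
proof -
  let ?a = "stirling_term m"
  \<comment> \<open>The sign splits as \<open>(-1) ^ n * (-1) ^ (M - n)\<close>. Summing the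
    triangle over \<open>j = M - n\<close> first leaves a partial alternating harmonic sum, whose
    \<open>j = 0\<close> term is 0.\<close>
  have conv: "(\<Sum>M<N. (-1) ^ M * (\<Sum>n\<le>M. ?a n * (1 / real (M - n)))) =
      - (\<Sum>n<N. (-1) ^ n * ?a n * alt_harm (N - n - 1))"
  proof -
    have sgn: "(-1 :: real) ^ M = (-1) ^ n * (-1) ^ (M - n)" if "n \<le> M" for n M
      using that by (simp flip: power_add)
    have "(\<Sum>M<N. (-1) ^ M * (\<Sum>n\<le>M. ?a n * (1 / real (M - n)))) =
        (\<Sum>M<N. \<Sum>n\<le>M. ((-1) ^ n * ?a n) * ((-1) ^ (M - n) * (1 / real (M - n))))"
      unfolding sum_distrib_left by (intro sum.cong refl) (simp add: sgn)
    also have "\<dots> = (\<Sum>(n, j)\<in>{(n, j). n + j < N}. ((-1) ^ n * ?a n) * ((-1) ^ j * (1 / real j)))"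
      by (rule sum.triangle_reindex [symmetric])
    also have "{(n, j). n + j < N} = Sigma {..<N} (\<lambda>n. {..<N - n})"
      by auto
    also have "(\<Sum>(n, j)\<in>Sigma {..<N} (\<lambda>n. {..<N - n}). ((-1) ^ n * ?a n) * ((-1) ^ j * (1 / real j))) =
        (\<Sum>n<N. ((-1) ^ n * ?a n) * (\<Sum>j<N - n. (-1) ^ j * (1 / real j)))"
      by (subst sum.Sigma [symmetric]) (auto simp: sum_distrib_left)
    also have "\<dots> = (\<Sum>n<N. ((-1) ^ n * ?a n) * (- alt_harm (N - n - 1)))"
    proof (intro sum.cong refl)
      fix n
      assume "n \<in> {..<N}"
      then have "N - n = Suc (N - n - 1)"
        by simp
      then show "(-1) ^ n * ?a n * (\<Sum>j<N - n. (-1) ^ j * (1 / real j)) =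
          (-1) ^ n * ?a n * - alt_harm (N - n - 1)"
        using alt_harm_eq [of "N - n - 1"] by simp
    qed
    finally show ?thesis
      by (simp add: sum_negf)
  qed
  \<comment> \<open>Summation by parts, using that \<open>(-1) ^ N / N\<close> is
    \<open>alt_harm (N - 1) - alt_harm N\<close> for positive \<open>N\<close>.\<close>
  have part: "(\<Sum>M<N. (-1) ^ M * ((\<Sum>n<M. ?a n) / real M)) =
      (\<Sum>n<N. alt_harm n * ?a n) - alt_harm (N - 1) * (\<Sum>n<N. ?a n)"
  proof (induction N)
    case (Suc N)
    show ?case
    proof (cases "N = 0")
      case False
      then have "alt_harm (N - 1) = alt_harm N + (-1) ^ N / real N"
        by (cases N) (simp_all add: alt_harm_def)
      then show ?thesis
        using Suc.IH by (simp add: algebra_simps)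
    qed simp
  qed simp
  have "(\<Sum>M<N. (-1) ^ M * (\<Sum>n\<le>M. ?a n * (1 / real (M - n)))) =
      real (m + 1) * (\<Sum>M<N. (-1) ^ M * stirling_term (m + 1) M) +
      (\<Sum>M<N. (-1) ^ M * ((\<Sum>n<M. ?a n) / real M))"
    unfolding stirling_term_convolution [OF assms] sum_distrib_left [of "real (m + 1)"]
      sum.distrib [symmetric]
    by (intro sum.cong refl) (simp only: distrib_left mult_ac)
  with conv part show ?thesis
    by linarith
qed

theorem theorem2p9:
  fixes m :: nat
  assumes "m \<ge> 1"
  shows "(\<lambda>k. let n = m + k in
            alt_harm n * real (stirling n m) / (real n * fact n))
         sums (zeta_2_ones (m - 1) * ln 2 - zeta_bar2_ones (m - 1) * ln 2
               - (real m + 1) * zeta_bar2_ones m)"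
proof -
  have abs_summable: "summable (\<lambda>n. \<bar>(-1) ^ n * stirling_term k n\<bar>)" for k
    using summable_stirling_term [of k] by (simp add: abs_mult stirling_term_nonneg)
  have alt: "(\<lambda>N. \<Sum>n<N. (-1) ^ n * stirling_term (m + 1) n) \<longlonglongrightarrow> zeta_bar2_ones m"
    unfolding zeta_bar2_ones_eq
    using summable_LIMSEQ [OF summable_rabs_cancel [OF abs_summable]] by simp
  have pos: "(\<lambda>N. \<Sum>n<N. stirling_term m n) \<longlonglongrightarrow> zeta_2_ones (m - 1)"
    using summable_LIMSEQ [OF summable_stirling_term [of m]] assms by (simp add: zeta_2_ones_eq)
  have harm: "(\<lambda>N. alt_harm (N - 1)) \<longlonglongrightarrow> ln 2"
    using alt_harm_tendsto by (subst filterlim_sequentially_Suc [symmetric]) simp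
  have mert: "(\<lambda>N. \<Sum>n<N. (-1) ^ n * stirling_term m n * alt_harm (N - n - 1))
      \<longlonglongrightarrow> zeta_bar2_ones (m - 1) * ln 2"
    using mertens_tendsto [OF abs_summable [of m] harm] assms by (simp add: zeta_bar2_ones_eq)
  have "(\<lambda>n. alt_harm n * stirling_term m n) sums
      (zeta_2_ones (m - 1) * ln 2 - zeta_bar2_ones (m - 1) * ln 2 - (real m + 1) * zeta_bar2_ones m)"
    unfolding sums_def stirling_term_partial_sums [OF assms]
    by (rule tendsto_eq_intros harm pos mert alt refl)+ simp
  \<comment> \<open>The terms with \<open>n < m\<close> vanish because \<open>s(n,m) = 0\<close>
    there, so the series may start at \<open>m\<close>.\<close>
  then have "(\<lambda>k. alt_harm (k + m) * stirling_term m (k + m)) sums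
      (zeta_2_ones (m - 1) * ln 2 - zeta_bar2_ones (m - 1) * ln 2 - (real m + 1) * zeta_bar2_ones m)"
    by (subst sums_zero_iff_shift) (simp_all add: stirling_term_def)
  then show ?thesis
    by (simp add: stirling_term_def Let_def add.commute)
qed

end
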